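(* The map $T$ (defined in the context) fulfills $$T(\mathbf{Y},\mathbf{X})=T\big(\mathbf{F}_{\mathbf{Y}}(\mathbf{Y}),\mathbf{F}_{\mathbf{X}}(\mathbf{X})\big),$$ where $\mathbf{F}_{\mathbf{X}}=(F_{X_1},\dots,F_{X_p})$ and $\mathbf{F}_{\mathbf{Y}}=(F_{Y_1},\dots,F_{Y_q})$ are the vectors of univariate marginal distribution functions, applied componentwise, i.e., $\mathbf{F}_{\mathbf{X}}(\mathbf{X})=(F_{X_1}(X_1),\dots,F_{X_p}(X_p))$ and $\mathbf{F}_{\mathbf{Y}}(\mathbf{Y})=(F_{Y_1}(Y_1),\dots,F_{Y_q}(Y_q))$.
   Context: All random vectors are defined on a common probability space $(\Omega,\mathcal{A},P)$: $\mathbf{X}=(X_1,\dots,X_p)$, $\mathbf{Y}=(Y_1,\dots,Y_q)$ with arbitrary $p,q\in\{1,2,\dots\}$. The components of $\mathbf{Y}$ are non-degenerate, i.e., no $Y_i$ is almost surely constant. $F_W$ denotes the distribution function of a real random variable $W$. For a non-degenerate real random variable $Y$ and a random vector $\mathbf{X}$ put $$\xi(Y,\mathbf{X}):=\frac{\int_{\mathbb{R}}\mathrm{Var}\big(P(Y\ge y\mid\mathbf{X})\big)\,\mathrm{d}P^{Y}(y)}{\int_{\mathbb{R}}\mathrm{Var}\big(\mathbf{1}_{\{Y\ge y\}}\big)\,\mathrm{d}P^{Y}(y)},$$ where $P^Y$ is the distribution of $Y$. Then $$T(\mathbf{Y},\mathbf{X}):=1-\frac{q-\sum_{i=1}^{q}\xi\big(Y_i,(\mathbf{X},Y_{i-1},\dots,Y_1)\big)}{q-\sum_{i=1}^{q}\xi\big(Y_i,(Y_{i-1},\dots,Y_1)\big)},\qquad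 \xi(Y_1,\emptyset):=0,$$ where for $i=1$ the vector $(\mathbf{X},Y_{i-1},\dots,Y_1)$ is $\mathbf{X}$ and $(Y_{i-1},\dots,Y_1)$ is empty. *)

theory Defs
  imports "HOL-Probability.Probability"
begin

text \<open>
  A random vector of arbitrary dimension is the list of its components, real random variables on a
  common probability space \<open>M\<close>. Concatenation \<open>(X, Y\<^sub>i, \<dots>, Y\<^sub>1)\<close> is then list concatenation.
\<close>

definition vec_sigma :: "'a measure \<Rightarrow> ('a \<Rightarrow> real) list \<Rightarrow> 'a measure" where
  "vec_sigma M Zs =
     vimage_algebra (space M) (\<lambda>\<omega>. \<lambda>j\<in>{..<length Zs}. (Zs ! j) \<omega>) (\<Pi>\<^sub>M j\<in>{..<length Zs}. borel)"

definition cond_prob_given ::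
    "'a measure \<Rightarrow> 'a set \<Rightarrow> ('a \<Rightarrow> real) list \<Rightarrow> 'a \<Rightarrow> real" where
  "cond_prob_given M A Zs = real_cond_exp M (vec_sigma M Zs) (indicator A)"

definition nondegenerate :: "'a measure \<Rightarrow> ('a \<Rightarrow> real) \<Rightarrow> bool" where
  "nondegenerate M W \<longleftrightarrow> \<not> (\<exists>c. AE \<omega> in M. W \<omega> = c)"

text \<open>The value for the empty vector is the convention \<open>\<xi>(Y, \<emptyset>) = 0\<close>.\<close>

definition xi :: "'a measure \<Rightarrow> ('a \<Rightarrow> real) \<Rightarrow> ('a \<Rightarrow> real) list \<Rightarrow> real" where
  "xi M Y Zs =
     (if Zs = [] then 0
      else (\<integral>y. prob_space.variance M (cond_prob_given M {\<omega> \<in> space M. Y \<omega> \<ge> y} Zs)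
              \<partial>distr M borel Y) /
           (\<integral>y. prob_space.variance M (indicator {\<omega> \<in> space M. Y \<omega> \<ge> y})
              \<partial>distr M borel Y))"

text \<open>
  List positions start at 0: for position \<open>i\<close> the response is \<open>Y\<^sub>i\<^sub>+\<^sub>1\<close>, and
  \<open>rev (take i Ys)\<close> is \<open>(Y\<^sub>i, \<dots>, Y\<^sub>1)\<close>.
\<close>

definition T_dep :: "'a measure \<Rightarrow> ('a \<Rightarrow> real) list \<Rightarrow> ('a \<Rightarrow> real) list \<Rightarrow> real" where
  "T_dep M Ys Xs =
     1 - (real (length Ys) - (\<Sum>i<length Ys. xi M (Ys ! i) (Xs @ rev (take i Ys)))) /
         (real (length Ys) - (\<Sum>i<length Ys. xi M (Ys ! i) (rev (take i Ys))))"

definition marginal_transform :: "'a measure \<Rightarrow> ('a \<Rightarrow> real) list \<Rightarrow> ('a \<Rightarrow> real) list" where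
  "marginal_transform M Ws = map (\<lambda>W \<omega>. cdf (distr M borel W) (W \<omega>)) Ws"

end

theory Submission
  imports Defs
begin

text \<open>
  Outside a \<open>P\<^sup>Z\<close>-null set the distribution function \<open>F\<close> of \<open>Z\<close> satisfies
  \<open>F z \<le> F x \<longleftrightarrow> z \<le> x\<close> for all \<open>x\<close>. Hence \<open>{F Y \<ge> F y} = {Y \<ge> y}\<close> for \<open>P\<^sup>Y\<close>-almost all \<open>y\<close>,
  and \<open>Z\<close> is almost surely a measurable function (the quantile function) of \<open>F Z\<close>, so that
  \<open>Z\<close> and \<open>F Z\<close> generate the same \<open>\<sigma>\<close>-algebra up to null sets. Therefore \<open>\<xi>\<close>, and with it \<open>T\<close>,
  does not change under the marginal transformations. Monotonicity in \<open>y\<close> provides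
  the measurability of the integrands that the change of variables requires.
\<close>

section \<open>Almost sure injectivity of a distribution function\<close>

text \<open>By monotonicity the set is an interval with left end \<open>r\<close> on which the
  distribution function is constant, and each \<open>{r<..q}\<close> with \<open>q\<close> in it has
  mass \<open>cdf M q - cdf M r \<le> 0\<close>.\<close>

lemma (in real_distribution) cdf_flat_null:
  "{z. r < z \<and> cdf M z \<le> cdf M r} \<in> null_sets M"
proof -
  let ?S = "{z. r < z \<and> cdf M z \<le> cdf M r}"
  have Ioc: "{r<..q} \<in> null_sets M" if "q \<in> ?S" for q
  proof -
    have "measure M {r<..q} = cdf M q - cdf M r"
      using that by (simp add: cdf_diff_eq)
    also have "\<dots> \<le> 0"
      using that by simp
    finally show ?thesis
      by (auto intro!: null_setsI simp: emeasure_eq_measure measure_le_0_iff)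
  qed
  have borel_mono: "cdf M \<in> borel_measurable borel"
    by (intro borel_measurable_mono monoI cdf_nondecreasing)
  have sets: "?S \<in> sets M"
    using borel_mono by simp
  \<comment> \<open>A maximum \<open>m\<close> may be irrational, so that rational right ends would
    miss it; then \<open>{r<..m}\<close> alone covers the set. Without a maximum, a rational lies
    between any point of the set and a larger one, and countably many intervals suffice.\<close>
  show ?thesis
  proof (cases "\<exists>m\<in>?S. \<forall>z\<in>?S. z \<le> m")
    case True
    then obtain m where "m \<in> ?S" "\<forall>z\<in>?S. z \<le> m"
      by blast
    moreover from this have "?S \<subseteq> {r<..m}"
      by auto
    ultimately show ?thesis
      using Ioc[of m] sets by (auto intro: null_sets_subset)
  next
    case False
    have "?S \<subseteq> (\<Union>q\<in>?S \<inter> \<rat>. {r<..q})"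
    proof
      fix z assume z: "z \<in> ?S"
      with False obtain z' where z': "z' \<in> ?S" "z < z'"
        by (auto simp: not_le)
      obtain q where q: "q \<in> \<rat>" "z < q" "q < z'"
        using Rats_dense_in_real[OF z'(2)] by blast
      have "cdf M q \<le> cdf M z'"
        using q by (intro cdf_nondecreasing) auto
      with z z' q have "q \<in> ?S \<inter> \<rat>" "z \<in> {r<..q}"
        by auto
      then show "z \<in> (\<Union>q\<in>?S \<inter> \<rat>. {r<..q})"
        by blast
    qed
    moreover have "(\<Union>q\<in>?S \<inter> \<rat>. {r<..q}) \<in> null_sets M"
      using Ioc by (intro null_sets_UN') (auto intro: countable_rat countable_subset)
    ultimately show ?thesis
      using sets by (auto intro: null_sets_subset)
  qed
qed

text \<open>One null set has to serve all real \<open>x\<close>, so only the flat parts starting at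
  rational points are discarded. If the equivalence failed for some \<open>x < z\<close>, then
  \<open>z\<close> would lie in the flat part of any rational between \<open>x\<close> and
  \<open>z\<close>.\<close>

lemma (in real_distribution) AE_cdf_le_iff:
  "AE z in M. \<forall>x. cdf M z \<le> cdf M x \<longleftrightarrow> z \<le> x"
proof -
  have "AE z in M. \<forall>r\<in>\<rat>. z \<notin> {z. r < z \<and> cdf M z \<le> cdf M r}"
    by (intro AE_ball_countable' AE_not_in cdf_flat_null countable_rat)
  then show ?thesis
  proof eventually_elim
    case (elim z)
    show ?case
    proof (intro allI iffI)
      fix x assume le: "cdf M z \<le> cdf M x"
      show "z \<le> x"
      proof (rule ccontr)
        assume "\<not> z \<le> x"
        then obtain r where r: "r \<in> \<rat>" "x < r" "r < z"
          using Rats_dense_in_real[of x z] by auto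
        have "cdf M x \<le> cdf M r"
          using r by (intro cdf_nondecreasing) auto
        with elim r le show False
          by force
      qed
    qed (rule cdf_nondecreasing)
  qed
qed

text \<open>The inverse is the quantile function \<open>I u = Inf {x. u \<le> cdf M x}\<close>. For
  almost all \<open>z\<close> the set for \<open>u = cdf M z\<close> is \<open>{z..}\<close>, whose
  infimum is \<open>z\<close>.\<close>

lemma (in real_distribution) cdf_AE_left_inverse:
  obtains G where "G \<in> borel_measurable borel" "AE z in M. G (cdf M z) = z"
proof
  interpret cdf_distribution M
    by unfold_locales
  \<comment> \<open>Measurability of \<open>I\<close> is available on the open unit interval. The
    value 1 can be attained with positive probability, so the constant outside is
    \<open>I 1\<close>, which keeps the inverse correct there.\<close>
  define G where "G u = (if u \<in> {0<..<1} then I u else I 1)" for u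
  have "(\<lambda>u. if u \<in> {0<..<1} then I u else I 1) \<in> borel_measurable borel"
    by (subst measurable_If_restrict_space_iff) (use measurable_CI in \<open>auto simp del: greaterThanLessThan_iff\<close>)
  then show "G \<in> borel_measurable borel"
    by (simp add: G_def[abs_def])
  show "AE z in M. G (cdf M z) = z"
    using AE_cdf_le_iff
  proof eventually_elim
    case (elim z)
    have I: "I (cdf M z) = z"
      using elim by (simp flip: atLeast_def)
    \<comment> \<open>Comparing with \<open>z - 1\<close> excludes \<open>cdf M z = 0\<close>, where
      \<open>G\<close> would return \<open>I 1\<close>.\<close>
    have "\<not> cdf M z \<le> cdf M (z - 1)"
      using elim by simp
    then have "0 < cdf M z"
      using cdf_nonneg[of "z - 1"] by linarith
    then show ?case
      using I cdf_bounded_prob[of z] by (cases "cdf M z = 1") (auto simp: G_def)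
  qed
qed

section \<open>Conditioning on \<sigma>-algebras that agree up to null sets\<close>

text \<open>The conditional expectation given \<open>G\<close> is a version of the one given
  \<open>F\<close>: it is measurable for the larger \<open>F\<close>, and its integral over a set of
  \<open>F\<close> can be computed over the almost surely equal set of \<open>G\<close>, where its
  defining property applies.\<close>

lemma (in finite_measure) real_cond_exp_cong_sets_AE:
  assumes F: "subalgebra M F" and GF: "subalgebra F G"
    and AE: "\<And>A. A \<in> sets F \<Longrightarrow> \<exists>B\<in>sets G. AE x in M. x \<in> A \<longleftrightarrow> x \<in> B"
    and f: "integrable M f"
  shows "AE x in M. real_cond_exp M F f x = real_cond_exp M G f x"
proof -
  have G: "subalgebra M G"
    using F GF by (auto simp: subalgebra_def)
  interpret F: finite_measure_subalgebra M F
    by unfold_locales (rule F)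
  interpret G: finite_measure_subalgebra M G
    by unfold_locales (rule G)
  have cong: "(\<integral>x\<in>A. h x \<partial>M) = (\<integral>x\<in>B. h x \<partial>M)"
    if "AE x in M. x \<in> A \<longleftrightarrow> x \<in> B" "A \<in> sets M" "B \<in> sets M" "integrable M h"
    for A B and h :: "'a \<Rightarrow> real"
    unfolding set_lebesgue_integral_def
  proof (rule integral_cong_AE)
    show "AE x in M. indicator A x *\<^sub>R h x = indicator B x *\<^sub>R h x"
      using that(1) by eventually_elim (auto simp: indicator_def)
  qed (use that in measurable)
  show ?thesis
  proof (rule F.real_cond_exp_charact)
    fix A assume A: "A \<in> sets F"
    with AE obtain B where B: "B \<in> sets G" "AE x in M. x \<in> A \<longleftrightarrow> x \<in> B"
      by blast
    have meas: "A \<in> sets M" "B \<in> sets M"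
      using A B F G by (auto simp: subalgebra_def)
    have "(\<integral>x\<in>A. f x \<partial>M) = (\<integral>x\<in>B. f x \<partial>M)"
      using B meas f by (intro cong)
    also have "\<dots> = (\<integral>x\<in>B. real_cond_exp M G f x \<partial>M)"
      using f B by (intro G.real_cond_exp_intA)
    also have "\<dots> = (\<integral>x\<in>A. real_cond_exp M G f x \<partial>M)"
      using B meas f by (intro cong[symmetric] G.real_cond_exp_int)
    finally show "(\<integral>x\<in>A. f x \<partial>M) = (\<integral>x\<in>A. real_cond_exp M G f x \<partial>M)" .
  next
    show "real_cond_exp M G f \<in> borel_measurable F"
      using GF by (rule measurable_from_subalg) simp
  qed (use f in \<open>auto intro: G.real_cond_exp_int\<close>)
qed

section \<open>The \<sigma>-algebra generated by a random vector\<close>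

lemma space_vec_sigma [simp]: "space (vec_sigma M Zs) = space M"
  by (simp add: vec_sigma_def)

lemma measurable_vec_sigma_nth:
  assumes "j < length Zs"
  shows "Zs ! j \<in> borel_measurable (vec_sigma M Zs)"
proof -
  have "(\<lambda>\<omega>. \<lambda>j\<in>{..<length Zs}. (Zs ! j) \<omega>)
      \<in> measurable (vec_sigma M Zs) (\<Pi>\<^sub>M j\<in>{..<length Zs}. borel)"
    unfolding vec_sigma_def by (rule measurable_vimage_algebra1) (auto simp: space_PiM)
  from measurable_compose[OF this measurable_component_singleton[of j]]
  show ?thesis
    using assms by simp
qed

lemma sets_vec_sigma:
  "sets (vec_sigma M Zs) =
     {(\<lambda>\<omega>. \<lambda>j\<in>{..<length Zs}. (Zs ! j) \<omega>) -` A \<inter> space M | A.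
        A \<in> sets (\<Pi>\<^sub>M j\<in>{..<length Zs}. borel)}"
  unfolding vec_sigma_def by (rule sets_vimage_algebra2) (auto simp: space_PiM)

text \<open>Minimality of the generated \<sigma>-algebra. It is used with \<open>N\<close> the whole
  space and with \<open>N\<close> generated by another vector.\<close>

lemma subalgebra_vec_sigma:
  assumes "space N = space M" "\<And>j. j < length Zs \<Longrightarrow> Zs ! j \<in> borel_measurable N"
  shows "subalgebra N (vec_sigma M Zs)"
proof -
  have "(\<lambda>\<omega>. \<lambda>j\<in>{..<length Zs}. (Zs ! j) \<omega>) \<in> measurable N (\<Pi>\<^sub>M j\<in>{..<length Zs}. borel)"
    using assms by (intro measurable_restrict) auto
  from measurable_sets[OF this] show ?thesis
    using assms by (auto simp: subalgebra_def sets_vec_sigma)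
qed

text \<open>\<open>Ws\<close> is everywhere a function of \<open>Zs\<close>, so its \<sigma>-algebra
  is contained in that of \<open>Zs\<close>. The reverse inclusion holds up to null sets, because
  \<open>G\<close> recovers \<open>Zs\<close> almost surely.\<close>

lemma (in prob_space) cond_prob_given_AE_left_inverse:
  assumes Zs: "\<And>j. j < length Zs \<Longrightarrow> Zs ! j \<in> borel_measurable M"
    and len: "length Ws = length Zs"
    and g: "\<And>j. j < length Zs \<Longrightarrow> g j \<in> borel_measurable borel"
    and Ws: "\<And>j \<omega>. j < length Zs \<Longrightarrow> (Ws ! j) \<omega> = g j ((Zs ! j) \<omega>)"
    and G: "\<And>j. j < length Zs \<Longrightarrow> G j \<in> borel_measurable borel"
    and inv: "\<And>j. j < length Zs \<Longrightarrow> AE \<omega> in M. G j ((Ws ! j) \<omega>) = (Zs ! j) \<omega>"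
    and A: "A \<in> sets M"
  shows "AE \<omega> in M. cond_prob_given M A Zs \<omega> = cond_prob_given M A Ws \<omega>"
  unfolding cond_prob_given_def
proof (rule real_cond_exp_cong_sets_AE)
  show "subalgebra M (vec_sigma M Zs)"
    using Zs by (intro subalgebra_vec_sigma) auto
  show "subalgebra (vec_sigma M Zs) (vec_sigma M Ws)"
  proof (rule subalgebra_vec_sigma)
    fix j assume j: "j < length Ws"
    have "Ws ! j = (\<lambda>\<omega>. g j ((Zs ! j) \<omega>))"
      using Ws j len by auto
    then show "Ws ! j \<in> borel_measurable (vec_sigma M Zs)"
      using measurable_compose[OF measurable_vec_sigma_nth g] j len by simp
  qed simp
  show "integrable M (indicator A :: 'a \<Rightarrow> real)"
    using A by (simp add: emeasure_eq_measure)
next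
  fix S assume "S \<in> sets (vec_sigma M Zs)"
  then obtain B where B: "B \<in> sets (\<Pi>\<^sub>M j\<in>{..<length Zs}. borel)"
      and S: "S = (\<lambda>\<omega>. \<lambda>j\<in>{..<length Zs}. (Zs ! j) \<omega>) -` B \<inter> space M"
    by (auto simp: sets_vec_sigma)
  \<comment> \<open>\<open>?V\<close> is the reconstruction of the vector \<open>Zs\<close> from
    \<open>Ws\<close>; the preimage of \<open>B\<close> under it is the set that replaces
    \<open>S\<close>.\<close>
  let ?V = "\<lambda>\<omega>. \<lambda>j\<in>{..<length Zs}. G j ((Ws ! j) \<omega>)"
  have "?V \<in> measurable (vec_sigma M Ws) (\<Pi>\<^sub>M j\<in>{..<length Zs}. borel)"
    using len by (intro measurable_restrict measurable_compose[OF measurable_vec_sigma_nth G]) auto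
  from measurable_sets[OF this B] have "?V -` B \<inter> space M \<in> sets (vec_sigma M Ws)"
    by simp
  moreover have "AE \<omega> in M. \<omega> \<in> S \<longleftrightarrow> \<omega> \<in> ?V -` B \<inter> space M"
  proof -
    have "AE \<omega> in M. \<forall>j\<in>{..<length Zs}. G j ((Ws ! j) \<omega>) = (Zs ! j) \<omega>"
      using inv by (intro AE_ball_countable') auto
    then show ?thesis
    proof eventually_elim
      case (elim \<omega>)
      then have "?V \<omega> = (\<lambda>j\<in>{..<length Zs}. (Zs ! j) \<omega>)"
        by (intro restrict_ext) auto
      then show ?case
        by (simp add: S)
    qed
  qed
  ultimately show "\<exists>B\<in>sets (vec_sigma M Ws). AE \<omega> in M. \<omega> \<in> S \<longleftrightarrow> \<omega> \<in> B"
    by blast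
qed

section \<open>Conditioning on the marginally transformed vector\<close>

lemma marginal_transform_simps [simp]:
  "length (marginal_transform M Zs) = length Zs"
  "marginal_transform M Zs = [] \<longleftrightarrow> Zs = []"
  "marginal_transform M (Zs @ Ws) = marginal_transform M Zs @ marginal_transform M Ws"
  "marginal_transform M (rev Zs) = rev (marginal_transform M Zs)"
  "marginal_transform M (take i Zs) = take i (marginal_transform M Zs)"
  "i < length Zs \<Longrightarrow>
     marginal_transform M Zs ! i = (\<lambda>\<omega>. cdf (distr M borel (Zs ! i)) ((Zs ! i) \<omega>))"
  by (auto simp: marginal_transform_def rev_map take_map)

lemma (in prob_space) borel_measurable_cdf_distr:
  assumes "Z \<in> borel_measurable M"
  shows "cdf (distr M borel Z) \<in> borel_measurable borel"
proof -
  interpret D: real_distribution "distr M borel Z"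
    using assms by simp
  show ?thesis
    by (intro borel_measurable_mono monoI D.cdf_nondecreasing)
qed

text \<open>Each component is recovered by its own quantile function. The event \<open>A\<close>
  stays fixed here; only the conditioning vector changes.\<close>

lemma (in prob_space) cond_prob_given_marginal_transform:
  assumes Zs: "\<And>Z. Z \<in> set Zs \<Longrightarrow> Z \<in> borel_measurable M" and A: "A \<in> sets M"
  shows "AE \<omega> in M. cond_prob_given M A Zs \<omega> = cond_prob_given M A (marginal_transform M Zs) \<omega>"
proof -
  have "\<exists>G. G \<in> borel_measurable borel \<and>
      (AE \<omega> in M. G (cdf (distr M borel Z) (Z \<omega>)) = Z \<omega>)" if "Z \<in> set Zs" for Z
  proof -
    have [measurable]: "Z \<in> borel_measurable M"
      using Zs that .
    interpret D: real_distribution "distr M borel Z"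
      by simp
    obtain G where "G \<in> borel_measurable borel"
        "AE z in distr M borel Z. G (cdf (distr M borel Z) z) = z"
      by (rule D.cdf_AE_left_inverse)
    then show ?thesis
      by (auto dest: AE_distrD[rotated])
  qed
  then obtain G where G: "\<And>Z. Z \<in> set Zs \<Longrightarrow> G Z \<in> borel_measurable borel"
      "\<And>Z. Z \<in> set Zs \<Longrightarrow> AE \<omega> in M. G Z (cdf (distr M borel Z) (Z \<omega>)) = Z \<omega>"
    by metis
  show ?thesis
    by (rule cond_prob_given_AE_left_inverse[where G = "\<lambda>j. G (Zs ! j)" and
          g = "\<lambda>j. cdf (distr M borel (Zs ! j))"])
      (use Zs A G in \<open>auto intro: borel_measurable_cdf_distr\<close>)
qed

section \<open>Measurability of the variance in the threshold\<close>

lemma (in prob_space) variance_cong_AE: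
  fixes f g :: "'a \<Rightarrow> real"
  assumes "AE x in M. f x = g x" "f \<in> borel_measurable M" "g \<in> borel_measurable M"
  shows "variance f = variance g"
proof -
  have "expectation f = expectation g"
    using assms by (intro integral_cong_AE)
  with assms show ?thesis
    by (intro integral_cong_AE) auto
qed

lemma borel_measurable_antimono:
  fixes f :: "real \<Rightarrow> real"
  assumes "antimono f"
  shows "f \<in> borel_measurable borel"
proof -
  have "mono (\<lambda>x. - f x)"
    using assms by (auto simp: mono_def antimono_def)
  from borel_measurable_mono[OF this] show ?thesis
    by simp
qed

text \<open>The variance is the second moment minus the square of the first, and both moments are
  antimono in \<open>y\<close>, hence Borel. The exceptional sets may depend on \<open>y\<close> and
  \<open>z\<close>, as they do for conditional probabilities whose versions are chosen separately
  for each threshold.\<close>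

lemma (in prob_space) borel_measurable_variance_antimono:
  fixes C :: "real \<Rightarrow> 'a \<Rightarrow> real"
  assumes C: "\<And>y. C y \<in> borel_measurable M"
    and nonneg: "\<And>y. AE x in M. 0 \<le> C y x"
    and le1: "\<And>y. AE x in M. C y x \<le> 1"
    and anti: "\<And>y z. y \<le> z \<Longrightarrow> AE x in M. C z x \<le> C y x"
  shows "(\<lambda>y. variance (C y)) \<in> borel_measurable borel"
proof -
  have int: "integrable M (C y)" for y
    using C nonneg[of y] le1[of y] by (intro integrable_const_bound[where B = 1]) auto
  have int2: "integrable M (\<lambda>x. (C y x)\<^sup>2)" for y
  proof (rule integrable_const_bound[where B = 1])
    show "AE x in M. norm ((C y x)\<^sup>2) \<le> 1"
      using nonneg[of y] le1[of y] by eventually_elim (simp add: power_le_one)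
  qed (use C in measurable)
  have "antimono (\<lambda>y. expectation (C y))"
    using anti int by (intro antimonoI integral_mono_AE)
  moreover have "antimono (\<lambda>y. expectation (\<lambda>x. (C y x)\<^sup>2))"
  proof (intro antimonoI integral_mono_AE int2)
    fix y z :: real assume "y \<le> z"
    show "AE x in M. (C z x)\<^sup>2 \<le> (C y x)\<^sup>2"
      using anti[OF \<open>y \<le> z\<close>] nonneg[of z] by eventually_elim (rule power_mono)
  qed
  ultimately have "(\<lambda>y. expectation (\<lambda>x. (C y x)\<^sup>2) - (expectation (C y))\<^sup>2) \<in> borel_measurable borel"
    by (intro borel_measurable_diff borel_measurable_power borel_measurable_antimono)
  then show ?thesis
    by (simp add: variance_eq[OF int int2])
qed

lemma (in prob_space) borel_measurable_variance_indicator_ge: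
  assumes [measurable]: "Y \<in> borel_measurable M"
  shows "(\<lambda>y::real. variance (indicator {\<omega> \<in> space M. Y \<omega> \<ge> y} :: 'a \<Rightarrow> real)) \<in> borel_measurable borel"
  by (rule borel_measurable_variance_antimono) (auto simp: indicator_def)

lemma borel_measurable_cond_prob_given:
  assumes "\<And>Z. Z \<in> set Zs \<Longrightarrow> Z \<in> borel_measurable M"
  shows "cond_prob_given M A Zs \<in> borel_measurable M"
  unfolding cond_prob_given_def using assms by simp

lemma (in prob_space) borel_measurable_variance_cond_prob_ge:
  assumes [measurable]: "Y \<in> borel_measurable M"
    and Zs: "\<And>Z. Z \<in> set Zs \<Longrightarrow> Z \<in> borel_measurable M"
  shows "(\<lambda>y::real. variance (cond_prob_given M {\<omega> \<in> space M. Y \<omega> \<ge> y} Zs)) \<in> borel_measurable borel"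
proof -
  interpret finite_measure_subalgebra M "vec_sigma M Zs"
    using Zs by unfold_locales (auto intro: subalgebra_vec_sigma)
  have int: "integrable M (indicator {\<omega> \<in> space M. Y \<omega> \<ge> y} :: 'a \<Rightarrow> real)" for y
    by (simp add: emeasure_eq_measure)
  show ?thesis
  proof (rule borel_measurable_variance_antimono)
    show "cond_prob_given M {\<omega> \<in> space M. Y \<omega> \<ge> y} Zs \<in> borel_measurable M" for y
      using Zs by (rule borel_measurable_cond_prob_given)
    show "AE \<omega> in M. 0 \<le> cond_prob_given M {\<omega> \<in> space M. Y \<omega> \<ge> y} Zs \<omega>" for y
      unfolding cond_prob_given_def using int by (intro real_cond_exp_ge_c) auto
    show "AE \<omega> in M. cond_prob_given M {\<omega> \<in> space M. Y \<omega> \<ge> y} Zs \<omega> \<le> 1" for y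
      unfolding cond_prob_given_def using int
      by (intro real_cond_exp_le_c) (auto simp: indicator_def)
    show "AE \<omega> in M. cond_prob_given M {\<omega> \<in> space M. Y \<omega> \<ge> z} Zs \<omega>
        \<le> cond_prob_given M {\<omega> \<in> space M. Y \<omega> \<ge> y} Zs \<omega>" if "y \<le> z" for y z
      unfolding cond_prob_given_def using int that
      by (intro real_cond_exp_mono) (auto simp: indicator_def)
  qed
qed

section \<open>Invariance of \<open>xi\<close> and \<open>T_dep\<close>\<close>

text \<open>Change of variables along \<open>F Y\<close>, shared by the numerator and the
  denominator of \<open>xi\<close>. The integrands are compared only at thresholds where the two
  events coincide, which is the case for almost every \<open>y\<close>.\<close>

lemma (in prob_space) integral_distr_cdf_transform:
  fixes g h :: "real \<Rightarrow> real"
  defines "F \<equiv> \<lambda>Y. cdf (distr M borel Y)"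
  assumes Y [measurable]: "Y \<in> borel_measurable M"
    and g [measurable]: "g \<in> borel_measurable borel"
    and h [measurable]: "h \<in> borel_measurable borel"
    and eq: "\<And>y. {\<omega> \<in> space M. F Y (Y \<omega>) \<ge> F Y y} = {\<omega> \<in> space M. Y \<omega> \<ge> y} \<Longrightarrow> h (F Y y) = g y"
  shows "(\<integral>y. h y \<partial>distr M borel (\<lambda>\<omega>. F Y (Y \<omega>))) = (\<integral>y. g y \<partial>distr M borel Y)"
proof -
  interpret D: real_distribution "distr M borel Y"
    by simp
  have F [measurable]: "F Y \<in> borel_measurable borel"
    unfolding F_def by (rule borel_measurable_cdf_distr[OF Y])
  have "(\<integral>y. h y \<partial>distr M borel (\<lambda>\<omega>. F Y (Y \<omega>))) = (\<integral>y. h (F Y y) \<partial>distr M borel Y)"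
    by (simp add: integral_distr)
  also have "\<dots> = (\<integral>y. g y \<partial>distr M borel Y)"
  proof (rule integral_cong_AE)
    show "AE y in distr M borel Y. h (F Y y) = g y"
      using D.AE_cdf_le_iff by eventually_elim (rule eq, simp add: F_def)
  qed measurable
  finally show ?thesis .
qed

lemma (in prob_space) xi_marginal_transform:
  assumes Y: "Y \<in> borel_measurable M"
    and Zs: "\<And>Z. Z \<in> set Zs \<Longrightarrow> Z \<in> borel_measurable M"
  shows "xi M (\<lambda>\<omega>. cdf (distr M borel Y) (Y \<omega>)) (marginal_transform M Zs) = xi M Y Zs"
proof -
  let ?FY = "\<lambda>\<omega>. cdf (distr M borel Y) (Y \<omega>)"
  let ?Ws = "marginal_transform M Zs"
  have FY: "?FY \<in> borel_measurable M"
    using measurable_compose[OF Y borel_measurable_cdf_distr[OF Y]] .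
  have Ws: "W \<in> borel_measurable M" if "W \<in> set ?Ws" for W
    using that Zs
    by (auto simp: marginal_transform_def
        intro!: measurable_compose[OF _ borel_measurable_cdf_distr])
  have "(\<integral>y. variance (indicator {\<omega> \<in> space M. ?FY \<omega> \<ge> y} :: 'a \<Rightarrow> real) \<partial>distr M borel ?FY) =
        (\<integral>y. variance (indicator {\<omega> \<in> space M. Y \<omega> \<ge> y} :: 'a \<Rightarrow> real) \<partial>distr M borel Y)"
    using Y FY
    by (intro integral_distr_cdf_transform borel_measurable_variance_indicator_ge) simp_all
  moreover have
    "(\<integral>y. variance (cond_prob_given M {\<omega> \<in> space M. ?FY \<omega> \<ge> y} ?Ws) \<partial>distr M borel ?FY) =
     (\<integral>y. variance (cond_prob_given M {\<omega> \<in> space M. Y \<omega> \<ge> y} Zs) \<partial>distr M borel Y)"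
  proof (intro integral_distr_cdf_transform borel_measurable_variance_cond_prob_ge)
    fix y
    assume "{\<omega> \<in> space M. cdf (distr M borel Y) y \<le> ?FY \<omega>} = {\<omega> \<in> space M. y \<le> Y \<omega>}"
    \<comment> \<open>With the events identified, what remains is to exchange the conditioning
      vector, which alters the conditional probability only on a null set.\<close>
    moreover have "variance (cond_prob_given M {\<omega> \<in> space M. y \<le> Y \<omega>} ?Ws) =
        variance (cond_prob_given M {\<omega> \<in> space M. y \<le> Y \<omega>} Zs)"
      using Y Zs Ws
      by (intro variance_cong_AE borel_measurable_cond_prob_given
          AE_symmetric[OF cond_prob_given_marginal_transform]) auto
    ultimately show
      "variance (cond_prob_given M {\<omega> \<in> space M. cdf (distr M borel Y) y \<le> ?FY \<omega>} ?Ws) =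
       variance (cond_prob_given M {\<omega> \<in> space M. y \<le> Y \<omega>} Zs)"
      by simp
  qed (use Y FY Zs Ws in auto)
  ultimately show ?thesis
    by (simp add: xi_def)
qed

theorem proposition2p4:
  fixes M :: "'a measure" and Xs Ys :: "('a \<Rightarrow> real) list" and p q :: nat
  assumes "prob_space M"
    and "p \<ge> 1" and "length Xs = p"
    and "q \<ge> 1" and "length Ys = q"
    and "\<And>X. X \<in> set Xs \<Longrightarrow> X \<in> borel_measurable M"
    and "\<And>Y. Y \<in> set Ys \<Longrightarrow> Y \<in> borel_measurable M"
    and "\<And>Y. Y \<in> set Ys \<Longrightarrow> nondegenerate M Y"
  shows "T_dep M Ys Xs = T_dep M (marginal_transform M Ys) (marginal_transform M Xs)"
proof -
  interpret prob_space M
    by fact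
  \<comment> \<open>The prefix \<open>Zs\<close> is kept general to cover both sums of
    \<open>T_dep\<close>: \<open>Xs\<close> for the numerator and the empty list for the
    denominator.\<close>
  have xi_eq: "xi M (marginal_transform M Ys ! i) (marginal_transform M Zs @ rev (take i (marginal_transform M Ys)))
      = xi M (Ys ! i) (Zs @ rev (take i Ys))"
    if "i < length Ys" "set Zs \<subseteq> set Xs" for i Zs
    using xi_marginal_transform[of "Ys ! i" "Zs @ rev (take i Ys)"] that assms(6,7)
    by (auto dest: in_set_takeD)
  show ?thesis
    using xi_eq[of _ Xs] xi_eq[of _ "[]"] by (simp add: T_dep_def marginal_transform_def)
qed

end
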